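(* The maps $\Phi:\mathcal{C}\to\mathcal{D}$ and $\Psi:\mathcal{D}\to\mathcal{C}$ satisfy $\Psi\circ\Phi=\mathrm{Id}_{\mathcal{C}}$ and $\Phi\circ\Psi=\mathrm{Id}_{\mathcal{D}}$.
   Context: Let $a_1<\dots<a_m$ be totally ordered primary colors; $\chi(A)=1$ if $A$ is true, $0$ otherwise, and $\delta_{pq}=\chi(p\le q)$. Let $\mathcal{O}=\mathbb{Z}\times\{a_1,\dots,a_m\}$ (primary parts; $(k,p)$ has size $k$ and color $p$), $\mathcal{E}=\mathbb{Z}\times\{a_1,\dots,a_m\}^2$ (secondary parts; $(k,p,q)$ has size $2k+\delta_{pq}$ and color $pq$), and let $\mathcal{O}'\subset\mathcal{O}$, $\mathcal{E}'\subset\mathcal{E}$ be the subsets with first coordinate in $\mathbb{Z}_{>0}$. The upper and lower halves of $(k,p,q)\in\mathcal{E}$ are $\gamma(k,p,q)=(k+\delta_{pq},p)$ and $\mu(k,p,q)=(k,q)$ in $\mathcal{O}$. On $\mathcal{O}$: $(k,p)>_c(l,q)\iff k-l\ge\delta_{pq}$. The relation $\gg_c$ on $\mathcal{O}\cup\mathcal{E}$ is: $(k,p)\gg_c(l,q)\iff k-l\ge 1+\delta_{pq}$; $(k,p)\gg_c(l,q,r)\iff k-(2l+\delta_{qr})\ge\delta_{pq}+\delta_{qr}$; $(k,p,q)\gg_c(l,r)\iff (2k+\delta_{pq})-l\ge 1+\delta_{pq}+\delta_{qr}$; $(k,p,q)\gg_c(l,r,t)\iff (2k+\delta_{pq})-(2l+\delta_{rt})\ge\delta_{pq}+2\delta_{qr}+\delta_{rt}$.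 $\mathcal{C}$ is the set of finite sequences $\lambda_1>_c\cdots>_c\lambda_s$ in $\mathcal{O}'$; $\mathcal{D}$ is the set of finite sequences $\nu_1\gg_c\cdots\gg_c\nu_t$ in $\mathcal{O}'\cup\mathcal{E}'$. $\Lambda:\mathcal{O}\times\mathcal{E}\to\mathcal{E}\times\mathcal{O}$ is the bijection $\Lambda((k,p),(l,q,r))=((l+\delta_{qr},p,q),(k-\delta_{pq}-\delta_{qr},r))$, with inverse $\Lambda^{-1}((l',p,q),(k',r))=((k'+\delta_{pq}+\delta_{qr},p),(l'-\delta_{qr},q,r))$. Definition of $\Phi(\lambda)$ for $\lambda=(\lambda_1,\dots,\lambda_s)\in\mathcal{C}$. Step 1: let $i_1$ be the smallest $i\in\{1,\dots,s-1\}$ with $\lambda_i\not\gg_c\lambda_{i+1}$, and recursively let $i_k$ be the smallest $i\in\{i_{k-1}+2,\dots,s-1\}$ with $\lambda_i\not\gg_c\lambda_{i+1}$, as long as one exists; replace, in place, each pair $(\lambda_{i_k},\lambda_{i_k+1})$ by the unique element of $\mathcal{E}'$ having $\lambda_{i_k}$ as upper half and $\lambda_{i_k+1}$ as lower half. Step 2: as long as the current sequence contains consecutive entries $(x,y)\in\mathcal{O}\times\mathcal{E}$ with $x\not\gg_c y$, choose such a pair and replace it by $\Lambda(x,y)$. The final sequence is $\Phi(\lambda)$. Definition of $\Psi(\nu)$ for $\nu\in\mathcal{D}$. Step 1: as long as the current sequence contains consecutive entries $(x,y)\in\mathcal{E}\times\mathcal{O}$ with $\mu(x)\not>_c y$,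 choose such a pair and replace it by $\Lambda^{-1}(x,y)$. Step 2: replace, in place, every element of $\mathcal{E}$ in the resulting sequence by its upper half followed by its lower half. The final sequence is $\Psi(\nu)$. Both procedures terminate, their results do not depend on the choices made, and they give maps $\Phi:\mathcal{C}\to\mathcal{D}$, $\Psi:\mathcal{D}\to\mathcal{C}$. *)

theory Defs
  imports "HOL-Library.FuncSet"
begin

section \<open>Primary and secondary parts\<close>

text \<open>The color type \<open>'c\<close> plays the role of the totally ordered set of primary colors.
  The secondary color of \<open>(k, p, q)\<close> is the ordered pair \<open>p q\<close>.\<close>

type_synonym 'c prim = "int \<times> 'c"
type_synonym 'c sec = "int \<times> 'c \<times> 'c"

text \<open>The disjoint union of primary and secondary parts.\<close>

datatype 'c part = Pri "'c prim" | Sec "'c sec"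

definition delta :: "'c::linorder \<Rightarrow> 'c \<Rightarrow> int" where
  "delta p q = of_bool (p \<le> q)"

fun upper :: "'c::linorder sec \<Rightarrow> 'c prim" where
  "upper (k, p, q) = (k + delta p q, p)"

fun lower :: "'c sec \<Rightarrow> 'c prim" where
  "lower (k, p, q) = (k, q)"

fun gt_c :: "'c::linorder prim \<Rightarrow> 'c prim \<Rightarrow> bool" where
  "gt_c (k, p) (l, q) \<longleftrightarrow> k - l \<ge> delta p q"

fun gg_c :: "'c::linorder part \<Rightarrow> 'c part \<Rightarrow> bool" where
  "gg_c (Pri (k, p)) (Pri (l, q)) \<longleftrightarrow> k - l \<ge> 1 + delta p q"
| "gg_c (Pri (k, p)) (Sec (l, q, r)) \<longleftrightarrow>
     k - (2 * l + delta q r) \<ge> delta p q + delta q r"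
| "gg_c (Sec (k, p, q)) (Pri (l, r)) \<longleftrightarrow>
     (2 * k + delta p q) - l \<ge> 1 + delta p q + delta q r"
| "gg_c (Sec (k, p, q)) (Sec (l, r, t)) \<longleftrightarrow>
     (2 * k + delta p q) - (2 * l + delta r t) \<ge> delta p q + 2 * delta q r + delta r t"

fun pos_part :: "'c part \<Rightarrow> bool" where
  "pos_part (Pri x) \<longleftrightarrow> fst x > 0"
| "pos_part (Sec e) \<longleftrightarrow> fst e > 0"

text \<open>Relations are only required between neighbours, i.e. between
  consecutive entries of a sequence.\<close>

definition C_seqs :: "'c::linorder prim list set" where
  "C_seqs = {xs. successively gt_c xs \<and> (\<forall>x\<in>set xs. fst x > 0)}"

definition D_seqs :: "'c::linorder part list set" where
  "D_seqs = {xs. successively gg_c xs \<and> (\<forall>x\<in>set xs. pos_part x)}"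


section \<open>The transformation \<open>\<Lambda>\<close>\<close>

fun Lam :: "'c::linorder prim \<times> 'c sec \<Rightarrow> 'c sec \<times> 'c prim" where
  "Lam ((k, p), (l, q, r)) = ((l + delta q r, p, q), (k - delta p q - delta q r, r))"

fun Lam_inv :: "'c::linorder sec \<times> 'c prim \<Rightarrow> 'c prim \<times> 'c sec" where
  "Lam_inv ((l, p, q), (k, r)) = ((k + delta p q + delta q r, p), (l - delta q r, q, r))"

lemma Lam_inv_Lam: "Lam_inv (Lam z) = z"
  by (cases z rule: Lam.cases) simp

lemma Lam_Lam_inv: "Lam (Lam_inv z) = z"
  by (cases z rule: Lam_inv.cases) simp

lemma bij_Lam: "bij Lam"
  by (rule bij_betw_byWitness[where f' = Lam_inv]) (auto simp: Lam_inv_Lam Lam_Lam_inv)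


section \<open>The map \<open>\<Phi>\<close>\<close>

definition join :: "'c::linorder prim \<Rightarrow> 'c prim \<Rightarrow> 'c sec" where
  "join x y = (THE e. fst e > 0 \<and> upper e = x \<and> lower e = y)"

lemma join_ex1:
  assumes "gt_c x y" "\<not> gg_c (Pri x) (Pri y)" "fst y > 0"
  shows "\<exists>!e. fst e > 0 \<and> upper e = x \<and> lower e = y"
proof -
  obtain k p l q where xy: "x = (k, p)" "y = (l, q)" by (metis surj_pair)
  have "k = l + delta p q" using assms by (simp add: xy)
  then show ?thesis
    using assms(3) by (intro ex1I[of _ "(l, p, q)"]) (auto simp: xy)
qed

text \<open>Scanning from the left realises the greedy choice of the indices \<open>i\<^sub>1, i\<^sub>2, \<dots>\<close>;
  see \<open>Phi1_least\<close> and \<open>Phi1_none\<close> below.\<close>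

fun Phi1 :: "'c::linorder prim list \<Rightarrow> 'c part list" where
  "Phi1 [] = []"
| "Phi1 [x] = [Pri x]"
| "Phi1 (x # y # zs) =
     (if gg_c (Pri x) (Pri y) then Pri x # Phi1 (y # zs) else Sec (join x y) # Phi1 zs)"

lemma Phi1_none:
  assumes "\<And>i. Suc i < length xs \<Longrightarrow> gg_c (Pri (xs ! i)) (Pri (xs ! Suc i))"
  shows "Phi1 xs = map Pri xs"
  using assms
proof (induction xs rule: Phi1.induct)
  case (3 x y zs)
  have "gg_c (Pri x) (Pri y)" using "3.prems"[of 0] by simp
  moreover have "Phi1 (y # zs) = map Pri (y # zs)"
    using "3.IH"(1) calculation "3.prems"[of "Suc i" for i] by auto
  ultimately show ?case by simp
qed auto

lemma Phi1_least:
  assumes "Suc i < length xs" "\<not> gg_c (Pri (xs ! i)) (Pri (xs ! Suc i))"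
    and "\<And>j. j < i \<Longrightarrow> gg_c (Pri (xs ! j)) (Pri (xs ! Suc j))"
  shows "Phi1 xs = map Pri (take i xs) @ Sec (join (xs ! i) (xs ! Suc i)) # Phi1 (drop (i + 2) xs)"
  using assms
proof (induction i arbitrary: xs)
  case 0
  then obtain x y zs where "xs = x # y # zs"
    by (metis Suc_length_conv less_iff_Suc_add add_Suc)
  then show ?case using 0 by simp
next
  case (Suc i)
  then obtain x y zs where xs: "xs = x # y # zs"
    by (metis Suc_length_conv less_iff_Suc_add add_Suc)
  have "Phi1 (y # zs) = map Pri (take i (y # zs)) @
      Sec (join ((y # zs) ! i) ((y # zs) ! Suc i)) # Phi1 (drop (i + 2) (y # zs))"
    by (rule Suc.IH) (use Suc.prems(1,2) Suc.prems(3)[of "Suc j" for j] in \<open>auto simp: xs\<close>)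
  moreover have "gg_c (Pri x) (Pri y)" using Suc.prems(3)[of 0] by (simp add: xs)
  ultimately show ?case by (simp add: xs)
qed

inductive Phi_step :: "'c::linorder part list \<Rightarrow> 'c part list \<Rightarrow> bool" where
  "\<lbrakk>\<not> gg_c (Pri x) (Sec y); Lam (x, y) = (y', x')\<rbrakk> \<Longrightarrow>
     Phi_step (us @ [Pri x, Sec y] @ vs) (us @ [Sec y', Pri x'] @ vs)"

text \<open>The final sequences that some run of a rewriting procedure can end with.\<close>

definition final_of :: "('a \<Rightarrow> 'a \<Rightarrow> bool) \<Rightarrow> 'a \<Rightarrow> 'a \<Rightarrow> bool" where
  "final_of step s t \<longleftrightarrow> step\<^sup>*\<^sup>* s t \<and> \<not> (\<exists>u. step t u)"

definition Phi :: "'c::linorder prim list \<Rightarrow> 'c part list" where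
  "Phi xs = (THE t. final_of Phi_step (Phi1 xs) t)"


section \<open>The map \<open>\<Psi>\<close>\<close>

inductive Psi_step :: "'c::linorder part list \<Rightarrow> 'c part list \<Rightarrow> bool" where
  "\<lbrakk>\<not> gt_c (lower x) y; Lam_inv (x, y) = (y', x')\<rbrakk> \<Longrightarrow>
     Psi_step (us @ [Sec x, Pri y] @ vs) (us @ [Pri y', Sec x'] @ vs)"

fun halves :: "'c::linorder part \<Rightarrow> 'c prim list" where
  "halves (Pri x) = [x]"
| "halves (Sec e) = [upper e, lower e]"

definition Psi :: "'c::linorder part list \<Rightarrow> 'c prim list" where
  "Psi xs = concat (map halves (THE t. final_of Psi_step xs t))"


section \<open>Both procedures terminate with a result independent of the choices made\<close>

lemma final_of_ex1:
  fixes f :: "'a \<Rightarrow> nat"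
  assumes dec: "\<And>s t. step s t \<Longrightarrow> f t < f s"
    and dia: "\<And>s t u. step s t \<Longrightarrow> step s u \<Longrightarrow> t = u \<or> (\<exists>v. step t v \<and> step u v)"
  shows "\<exists>!t. final_of step s t"
proof (induction "f s" arbitrary: s rule: less_induct)
  case less
  show ?case
  proof (cases "\<exists>t. step s t")
    case False
    then show ?thesis
      unfolding final_of_def by (metis converse_rtranclpE rtranclp.rtrancl_refl)
  next
    case True
    then obtain t where t: "step s t" by blast
    obtain n where n: "final_of step t n" and n': "\<And>n'. final_of step t n' \<Longrightarrow> n' = n"
      using less[OF dec[OF t]] by blast
    have "final_of step s n"
      using n t unfolding final_of_def by (meson converse_rtranclp_into_rtranclp)
    moreover have "m = n" if m: "final_of step s m" for m
    proof -
      obtain u where u: "step s u" "final_of step u m"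
        using m True unfolding final_of_def by (metis converse_rtranclpE)
      show ?thesis
      proof (cases "t = u")
        case True
        then show ?thesis using u n' by blast
      next
        case False
        then obtain v where v: "step t v" "step u v" using dia[OF t u(1)] by blast
        have "f v < f s" using dec[OF v(1)] dec[OF t] by simp
        then obtain w where w: "final_of step v w" using less by blast
        have "final_of step t w" "final_of step u w"
          using w v unfolding final_of_def by (meson converse_rtranclp_into_rtranclp)+
        then show ?thesis using n' u(2) less[OF dec[OF u(1)]] by blast
      qed
    qed
    ultimately show ?thesis by blast
  qed
qed

fun ps_inversions :: "nat \<Rightarrow> 'c part list \<Rightarrow> nat" where
  "ps_inversions n [] = 0"
| "ps_inversions n (Pri x # xs) = ps_inversions (Suc n) xs"
| "ps_inversions n (Sec e # xs) = n + ps_inversions n xs"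

fun sp_inversions :: "nat \<Rightarrow> 'c part list \<Rightarrow> nat" where
  "sp_inversions n [] = 0"
| "sp_inversions n (Sec e # xs) = sp_inversions (Suc n) xs"
| "sp_inversions n (Pri x # xs) = n + sp_inversions n xs"

lemma ps_inversions_mono:
  assumes "\<And>n. ps_inversions n xs < ps_inversions n ys"
  shows "ps_inversions n (us @ xs) < ps_inversions n (us @ ys)"
  using assms by (induction n us rule: ps_inversions.induct) auto

lemma sp_inversions_mono:
  assumes "\<And>n. sp_inversions n xs < sp_inversions n ys"
  shows "sp_inversions n (us @ xs) < sp_inversions n (us @ ys)"
  using assms by (induction n us rule: sp_inversions.induct) auto

lemma Phi_step_decreases: "Phi_step s t \<Longrightarrow> ps_inversions 0 t < ps_inversions 0 s"
  by (erule Phi_step.cases) (auto intro!: ps_inversions_mono)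

lemma Psi_step_decreases: "Psi_step s t \<Longrightarrow> sp_inversions 0 t < sp_inversions 0 s"
  by (erule Psi_step.cases) (auto intro!: sp_inversions_mono)

lemma Phi_terminates: "wfP (\<lambda>t s. Phi_step s t)"
  by (rule wfp_if_convertible_to_nat[where f = "ps_inversions 0"]) (rule Phi_step_decreases)

lemma Psi_terminates: "wfP (\<lambda>t s. Psi_step s t)"
  by (rule wfp_if_convertible_to_nat[where f = "sp_inversions 0"]) (rule Psi_step_decreases)

lemma two_redexes:
  assumes "us @ [a, b] @ vs = us' @ [a', b'] @ vs'" "b \<noteq> a'" "b' \<noteq> a"
  shows "(us = us' \<and> a = a' \<and> b = b' \<and> vs = vs') \<or>
    (\<exists>ws. us' = us @ [a, b] @ ws \<and> vs = ws @ [a', b'] @ vs') \<or>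
    (\<exists>ws. us = us' @ [a', b'] @ ws \<and> vs' = ws @ [a, b] @ vs)"
  using assms by (auto simp: append_eq_append_conv2 Cons_eq_append_conv append_eq_Cons_conv)

lemma Phi_step_diamond:
  assumes "Phi_step s t" "Phi_step s u"
  shows "t = u \<or> (\<exists>v. Phi_step t v \<and> Phi_step u v)"
proof -
  obtain x y x' y' us vs where 1: "\<not> gg_c (Pri x) (Sec y)" "Lam (x, y) = (y', x')"
    "s = us @ [Pri x, Sec y] @ vs" "t = us @ [Sec y', Pri x'] @ vs"
    using assms(1) by (cases rule: Phi_step.cases) blast
  obtain a b a' b' us' vs' where 2: "\<not> gg_c (Pri a) (Sec b)" "Lam (a, b) = (b', a')"
    "s = us' @ [Pri a, Sec b] @ vs'" "u = us' @ [Sec b', Pri a'] @ vs'"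
    using assms(2) by (cases rule: Phi_step.cases) blast
  have "us @ [Pri x, Sec y] @ vs = us' @ [Pri a, Sec b] @ vs'" using 1 2 by simp
  from two_redexes[OF this] consider
      "us = us'" "x = a" "y = b" "vs = vs'"
    | ws where "us' = us @ [Pri x, Sec y] @ ws" "vs = ws @ [Pri a, Sec b] @ vs'"
    | ws where "us = us' @ [Pri a, Sec b] @ ws" "vs' = ws @ [Pri x, Sec y] @ vs"
    by auto
  then show ?thesis
  proof cases
    case 1
    then show ?thesis using \<open>Lam (x, y) = _\<close> \<open>t = _\<close> 2 by simp
  next
    case (2 ws)
    then show ?thesis
      using Phi_step.intros[OF \<open>\<not> gg_c (Pri a) (Sec b)\<close> \<open>Lam (a, b) = _\<close>,
          of "us @ [Sec y', Pri x'] @ ws" vs']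
        Phi_step.intros[OF \<open>\<not> gg_c (Pri x) (Sec y)\<close> \<open>Lam (x, y) = _\<close>,
          of us "ws @ [Sec b', Pri a'] @ vs'"] \<open>t = _\<close> \<open>u = _\<close> by auto
  next
    case (3 ws)
    then show ?thesis
      using Phi_step.intros[OF \<open>\<not> gg_c (Pri x) (Sec y)\<close> \<open>Lam (x, y) = _\<close>,
          of "us' @ [Sec b', Pri a'] @ ws" vs]
        Phi_step.intros[OF \<open>\<not> gg_c (Pri a) (Sec b)\<close> \<open>Lam (a, b) = _\<close>,
          of us' "ws @ [Sec y', Pri x'] @ vs"] \<open>t = _\<close> \<open>u = _\<close> by auto
  qed
qed

lemma Psi_step_diamond:
  assumes "Psi_step s t" "Psi_step s u"
  shows "t = u \<or> (\<exists>v. Psi_step t v \<and> Psi_step u v)"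
proof -
  obtain x y x' y' us vs where 1: "\<not> gt_c (lower x) y" "Lam_inv (x, y) = (y', x')"
    "s = us @ [Sec x, Pri y] @ vs" "t = us @ [Pri y', Sec x'] @ vs"
    using assms(1) by (cases rule: Psi_step.cases) blast
  obtain a b a' b' us' vs' where 2: "\<not> gt_c (lower a) b" "Lam_inv (a, b) = (b', a')"
    "s = us' @ [Sec a, Pri b] @ vs'" "u = us' @ [Pri b', Sec a'] @ vs'"
    using assms(2) by (cases rule: Psi_step.cases) blast
  have "us @ [Sec x, Pri y] @ vs = us' @ [Sec a, Pri b] @ vs'" using 1 2 by simp
  from two_redexes[OF this] consider
      "us = us'" "x = a" "y = b" "vs = vs'"
    | ws where "us' = us @ [Sec x, Pri y] @ ws" "vs = ws @ [Sec a, Pri b] @ vs'"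
    | ws where "us = us' @ [Sec a, Pri b] @ ws" "vs' = ws @ [Sec x, Pri y] @ vs"
    by auto
  then show ?thesis
  proof cases
    case 1
    then show ?thesis using \<open>Lam_inv (x, y) = _\<close> \<open>t = _\<close> 2 by simp
  next
    case (2 ws)
    then show ?thesis
      using Psi_step.intros[OF \<open>\<not> gt_c (lower a) b\<close> \<open>Lam_inv (a, b) = _\<close>,
          of "us @ [Pri y', Sec x'] @ ws" vs']
        Psi_step.intros[OF \<open>\<not> gt_c (lower x) y\<close> \<open>Lam_inv (x, y) = _\<close>,
          of us "ws @ [Pri b', Sec a'] @ vs'"] \<open>t = _\<close> \<open>u = _\<close> by auto
  next
    case (3 ws)
    then show ?thesis
      using Psi_step.intros[OF \<open>\<not> gt_c (lower x) y\<close> \<open>Lam_inv (x, y) = _\<close>,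
          of "us' @ [Pri b', Sec a'] @ ws" vs]
        Psi_step.intros[OF \<open>\<not> gt_c (lower a) b\<close> \<open>Lam_inv (a, b) = _\<close>,
          of us' "ws @ [Pri y', Sec x'] @ vs"] \<open>t = _\<close> \<open>u = _\<close> by auto
  qed
qed

lemma Phi_final_ex1: "\<exists>!t. final_of Phi_step s t"
  by (rule final_of_ex1[of _ "ps_inversions 0"]) (auto dest: Phi_step_decreases Phi_step_diamond)

lemma Psi_final_ex1: "\<exists>!t. final_of Psi_step s t"
  by (rule final_of_ex1[of _ "sp_inversions 0"]) (auto dest: Psi_step_decreases Psi_step_diamond)

end

theory Submission
  imports Defs
begin

text \<open>Neither \<open>\<Lambda>\<close> nor \<open>\<Lambda>\<inverse>\<close> changes the word of primary colors obtained by
  replacing every part by the colors of its halves: a crossing only moves a secondary part one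
  letter to the left or to the right. Subtract from the size of every primary part, and of the
  lower half of every secondary part, the number of weak ascents of the color word from its letter
  onwards. In these normalized values, a crossing merely exchanges a primary value with a secondary
  one: both the sequence of primary values and the sequence of secondary values are invariants
  (\<open>vals_append_cong\<close>).

  Call a sequence coherent if its primary values decrease strictly, its secondary values decrease
  weakly, all its parts are positive, and its neighbours satisfy weak conditions: a primary part
  is \<open>\<gg>\<^sub>c\<close> the upper half of a secondary part on its right, and \<open>\<gg>\<^sub>c\<close> holds between all other
  neighbours. The weak condition on \<open>(x, y) \<in> \<O> \<times> \<E>\<close> says exactly that \<open>\<Psi>\<close> undoes the replacement of
  \<open>(x, y)\<close> by \<open>\<Lambda>(x, y)\<close>, and the one on \<open>\<E> \<times> \<O>\<close> says the same with the two maps exchanged. Since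
  the normalized values also control the new neighbours that a crossing creates, coherence is
  preserved by every step, and every step between coherent sequences is reversed by a step of the
  other procedure (\<open>coherent_Phi_step\<close>, \<open>coherent_Psi_step\<close>).

  It remains to identify the two ends. The coherent sequences on which \<open>\<Phi>\<close> has no step left are
  the elements of \<open>\<D>\<close> (\<open>D_iff_coherent\<close>); those on which \<open>\<Psi>\<close> has no step left are the greedy
  sequences (\<open>greedy_iff_coherent\<close>), and these correspond to \<open>\<C>\<close> by joining and splitting parts
  (\<open>Phi1_C\<close>, \<open>halves_greedy\<close>). Hence a run of one procedure, read backwards, is a run of the other
  (\<open>final_of_Phi_iff_Psi\<close>).\<close>


section \<open>Color words and normalized values\<close>

lemma delta_nonneg: "0 \<le> delta p q" and delta_le_1: "delta p q \<le> 1"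
  by (simp_all add: delta_def)

text \<open>The word of the primary colors of all the halves, from left to right.\<close>

fun colors :: "'c part list \<Rightarrow> 'c list" where
  "colors [] = []"
| "colors (Pri (k, p) # xs) = p # colors xs"
| "colors (Sec (k, p, q) # xs) = p # q # colors xs"

text \<open>The number of weak ascents of a word, i.e. the sum of \<open>\<delta>\<close> over its pairs of neighbours.\<close>

fun ascents :: "'c::linorder list \<Rightarrow> int" where
  "ascents [] = 0"
| "ascents [c] = 0"
| "ascents (c # d # w) = delta c d + ascents (d # w)"

text \<open>The normalized values of the primary parts, from left to right. Ascents are counted to
  the right of a letter, so that the values of a suffix do not depend on what precedes it.\<close>

fun pvals :: "'c::linorder part list \<Rightarrow> int list" where
  "pvals [] = []"
| "pvals (Pri (k, p) # xs) = (k - ascents (p # colors xs)) # pvals xs"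
| "pvals (Sec e # xs) = pvals xs"

text \<open>The normalized values of the secondary parts, computed from their lower halves. The upper
  half \<open>(k + \<delta>\<^sub>p\<^sub>q, p)\<close> yields the same value, since the pair \<open>p q\<close> adds \<open>\<delta>\<^sub>p\<^sub>q\<close> ascents.\<close>

fun svals :: "'c::linorder part list \<Rightarrow> int list" where
  "svals [] = []"
| "svals (Pri x # xs) = svals xs"
| "svals (Sec (k, p, q) # xs) = (k - ascents (q # colors xs)) # svals xs"

lemma vals_append_cong:
  assumes "colors xs = colors ys" "pvals xs = pvals ys" "svals xs = svals ys"
  shows "colors (us @ xs) = colors (us @ ys) \<and> pvals (us @ xs) = pvals (us @ ys) \<and>
    svals (us @ xs) = svals (us @ ys)"
  using assms by (induction us rule: colors.induct) auto

lemma pvals_sorted_suffix: "sorted_wrt (>) (pvals (us @ xs)) \<Longrightarrow> sorted_wrt (>) (pvals xs)"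
  by (induction us rule: colors.induct) auto

lemma svals_sorted_suffix: "sorted_wrt (\<ge>) (svals (us @ xs)) \<Longrightarrow> sorted_wrt (\<ge>) (svals xs)"
  by (induction us rule: colors.induct) auto


section \<open>Coherent sequences\<close>

text \<open>The conditions on neighbours that hold throughout both procedures.\<close>

fun weak_adj :: "'c::linorder part \<Rightarrow> 'c part \<Rightarrow> bool" where
  "weak_adj (Pri x) (Sec y) \<longleftrightarrow> gg_c (Pri x) (Pri (upper y))"
| "weak_adj a b \<longleftrightarrow> gg_c a b"

text \<open>The common invariant of the two procedures. The conditions on the values concern all the
  primary (secondary) parts, not only neighbours.\<close>

definition coherent :: "'c::linorder part list \<Rightarrow> bool" where
  "coherent xs \<longleftrightarrow> sorted_wrt (>) (pvals xs) \<and> sorted_wrt (\<ge>) (svals xs) \<and>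
     successively weak_adj xs \<and> (\<forall>x\<in>set xs. pos_part x)"

lemma gg_prim_if_sorted:
  assumes "sorted_wrt (>) (pvals (us @ Pri x # Pri y # vs))"
  shows "gg_c (Pri x) (Pri y)"
  using pvals_sorted_suffix[OF assms] by (cases x; cases y) auto

lemma gg_sec_if_sorted:
  assumes "sorted_wrt (\<ge>) (svals (us @ Sec x # Sec y # vs))"
  shows "gg_c (Sec x) (Sec y)"
  using svals_sorted_suffix[OF assms] by (cases x; cases y) auto

lemma successively_iff_adjacent:
  "successively R xs \<longleftrightarrow> (\<forall>us a b vs. xs = us @ a # b # vs \<longrightarrow> R a b)"
proof
  assume "successively R xs"
  then show "\<forall>us a b vs. xs = us @ a # b # vs \<longrightarrow> R a b"
    by (auto simp: successively_append_iff)
next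
  show "\<forall>us a b vs. xs = us @ a # b # vs \<longrightarrow> R a b \<Longrightarrow> successively R xs"
  proof (induction xs rule: induct_list012)
    case (3 x y zs)
    have "successively R (y # zs)"
      by (rule "3.IH"(2)) (use "3.prems" in \<open>metis append_Cons\<close>)
    moreover have "R x y" using "3.prems" by blast
    ultimately show ?case by simp
  qed auto
qed

lemma successively_replace_pair:
  assumes "successively R (us @ [a, b] @ vs)" "R a' b'"
    and "\<And>ws z. us = ws @ [z] \<Longrightarrow> R z a'"
    and "\<And>w ws. vs = w # ws \<Longrightarrow> R b' w"
  shows "successively R (us @ [a', b'] @ vs)"
proof -
  have "successively R us" "successively R vs"
    using assms(1) by (auto simp: successively_append_iff successively_Cons)
  moreover have "us \<noteq> [] \<Longrightarrow> R (last us) a'" using assms(3) by (metis append_butlast_last_id)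
  moreover have "vs \<noteq> [] \<Longrightarrow> R b' (hd vs)" using assms(4) by (metis list.collapse)
  ultimately show ?thesis using assms(2) by (auto simp: successively_append_iff successively_Cons)
qed

section \<open>Coherence is preserved, and steps are mutually inverse\<close>

lemma coherent_Phi_step:
  assumes "coherent s" "Phi_step s t"
  shows "coherent t \<and> Psi_step t s"
proof -
  obtain k p l q r us vs where s: "s = us @ [Pri (k, p), Sec (l, q, r)] @ vs"
    and t: "t = us @ [Sec (l + delta q r, p, q), Pri (k - delta p q - delta q r, r)] @ vs"
    and red: "\<not> gg_c (Pri (k, p)) (Sec (l, q, r))"
    using assms(2) by (cases rule: Phi_step.cases) (auto split: prod.splits)
  have succ: "successively weak_adj s" using assms(1) by (simp add: coherent_def)
  have pos: "\<forall>x\<in>set s. pos_part x" using assms(1) by (simp add: coherent_def)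
  have xy: "k \<ge> l + delta q r + delta p q + 1"
    using succ[unfolded successively_iff_adjacent, rule_format, of us "Pri (k, p)" "Sec (l, q, r)" vs]
    by (simp add: s)
  have l: "l > 0" using pos by (simp add: s)
  \<comment> \<open>The pair and its replacement have the same colors and values, hence so have \<open>s\<close> and \<open>t\<close>.\<close>
  have vals: "pvals t = pvals s \<and> svals t = svals s"
    unfolding s t by (intro conjI vals_append_cong[THEN conjunct2, THEN conjunct1]
      vals_append_cong[THEN conjunct2, THEN conjunct2]) auto
  then have sorted: "sorted_wrt (>) (pvals s)" "sorted_wrt (\<ge>) (svals s)"
    "sorted_wrt (>) (pvals t)" "sorted_wrt (\<ge>) (svals t)"
    using assms(1) by (auto simp: coherent_def)
  have "successively weak_adj t"
    unfolding t
  proof (rule successively_replace_pair[OF succ[unfolded s]])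
    show "weak_adj (Sec (l + delta q r, p, q)) (Pri (k - delta p q - delta q r, r))"
      using red by simp
  next
    fix ws z assume us: "us = ws @ [z]"
    show "weak_adj z (Sec (l + delta q r, p, q))"
    proof (cases z)
      case (Pri a)
      then have "gg_c (Pri a) (Pri (k, p))"
        using gg_prim_if_sorted[of ws a] sorted(1) by (simp add: s us)
      then show ?thesis using xy by (cases a) (auto simp: Pri)
    next
      case (Sec a)
      then show ?thesis using gg_sec_if_sorted[of ws a] sorted(4) by (simp add: t us)
    qed
  next
    fix w ws assume vs: "vs = w # ws"
    show "weak_adj (Pri (k - delta p q - delta q r, r)) w"
    proof (cases w)
      case (Pri a)
      then show ?thesis
        using gg_prim_if_sorted[of "us @ [Sec (l + delta q r, p, q)]" _ a ws] sorted(3)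
        by (simp add: t vs)
    next
      case (Sec a)
      then have "gg_c (Sec (l, q, r)) (Sec a)"
        using gg_sec_if_sorted[of "us @ [Pri (k, p)]" _ a ws] sorted(2) by (simp add: s vs)
      then show ?thesis using xy by (cases a) (auto simp: Sec)
    qed
  qed
  moreover have "\<forall>x\<in>set t. pos_part x"
    using pos xy l delta_nonneg[of q r] by (auto simp: s t)
  ultimately have "coherent t" using sorted by (simp add: coherent_def)
  moreover have "Psi_step t s"
    unfolding s t by (rule Psi_step.intros) (use xy in auto)
  ultimately show ?thesis by blast
qed

lemma coherent_Psi_step:
  assumes "coherent s" "Psi_step s t"
  shows "coherent t \<and> Phi_step t s"
proof -
  obtain l p q k r us vs where s: "s = us @ [Sec (l, p, q), Pri (k, r)] @ vs"
    and t: "t = us @ [Pri (k + delta p q + delta q r, p), Sec (l - delta q r, q, r)] @ vs"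
    and red: "\<not> gt_c (l, q) (k, r)"
    using assms(2) by (cases rule: Psi_step.cases) (auto split: prod.splits)
  have succ: "successively weak_adj s" using assms(1) by (simp add: coherent_def)
  have pos: "\<forall>x\<in>set s. pos_part x" using assms(1) by (simp add: coherent_def)
  have xy: "2 * l \<ge> k + delta q r + 1"
    using succ[unfolded successively_iff_adjacent, rule_format, of us "Sec (l, p, q)" "Pri (k, r)" vs]
    by (simp add: s)
  have k: "k > 0" using pos by (simp add: s)
  \<comment> \<open>The pair and its replacement have the same colors and values, hence so have \<open>s\<close> and \<open>t\<close>.\<close>
  have vals: "pvals t = pvals s \<and> svals t = svals s"
    unfolding s t by (intro conjI vals_append_cong[THEN conjunct2, THEN conjunct1]
      vals_append_cong[THEN conjunct2, THEN conjunct2]) auto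
  then have sorted: "sorted_wrt (>) (pvals s)" "sorted_wrt (\<ge>) (svals s)"
    "sorted_wrt (>) (pvals t)" "sorted_wrt (\<ge>) (svals t)"
    using assms(1) by (auto simp: coherent_def)
  have "successively weak_adj t"
    unfolding t
  proof (rule successively_replace_pair[OF succ[unfolded s]])
    show "weak_adj (Pri (k + delta p q + delta q r, p)) (Sec (l - delta q r, q, r))"
      using red by simp
  next
    fix ws z assume us: "us = ws @ [z]"
    show "weak_adj z (Pri (k + delta p q + delta q r, p))"
    proof (cases z)
      case (Pri a)
      then show ?thesis using gg_prim_if_sorted[of ws a] sorted(3) by (simp add: t us)
    next
      case (Sec a)
      then have "gg_c (Sec a) (Sec (l, p, q))"
        using gg_sec_if_sorted[of ws a] sorted(2) by (simp add: s us)
      then show ?thesis using xy delta_nonneg[of p q] delta_nonneg[of "snd (snd a)" p]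
        by (cases a) (auto simp: Sec)
    qed
  next
    fix w ws assume vs: "vs = w # ws"
    show "weak_adj (Sec (l - delta q r, q, r)) w"
    proof (cases w)
      case (Pri a)
      then have "gg_c (Pri (k, r)) (Pri a)"
        using gg_prim_if_sorted[of "us @ [Sec (l, p, q)]" _ a ws] sorted(1) by (simp add: s vs)
      then show ?thesis using xy delta_le_1[of q r] by (cases a) (auto simp: Pri)
    next
      case (Sec a)
      then show ?thesis
        using gg_sec_if_sorted[of "us @ [Pri (k + delta p q + delta q r, p)]" _ a ws] sorted(4)
        by (simp add: t vs)
    qed
  qed
  \<comment> \<open>If \<open>\<delta>\<^sub>q\<^sub>r = 1\<close> then \<open>2 * l \<ge> 3\<close>, hence \<open>l \<ge> 2\<close>.\<close>
  moreover have "k + delta p q + delta q r > 0" "l - delta q r > 0"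
    using k xy delta_nonneg[of p q] delta_nonneg[of q r] delta_le_1[of q r] by linarith+
  then have "\<forall>x\<in>set t. pos_part x" using pos by (auto simp: s t)
  ultimately have "coherent t" using sorted by (simp add: coherent_def)
  moreover have "Phi_step t s"
    unfolding s t by (rule Phi_step.intros) (use xy in auto)
  ultimately show ?thesis by blast
qed

lemma coherent_Phi_steps:
  assumes "Phi_step\<^sup>*\<^sup>* s t" "coherent s"
  shows "coherent t \<and> Psi_step\<^sup>*\<^sup>* t s"
  using assms
  by induction (auto dest: coherent_Phi_step intro: converse_rtranclp_into_rtranclp)

lemma coherent_Psi_steps:
  assumes "Psi_step\<^sup>*\<^sup>* s t" "coherent s"
  shows "coherent t \<and> Phi_step\<^sup>*\<^sup>* t s"
  using assms
  by induction (auto dest: coherent_Psi_step intro: converse_rtranclp_into_rtranclp)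

lemma Phi_irreducible_iff:
  "(\<nexists>u. Phi_step t u) \<longleftrightarrow> (\<forall>us x y vs. t = us @ Pri x # Sec y # vs \<longrightarrow> gg_c (Pri x) (Sec y))"
proof -
  have "(\<exists>u. Phi_step t u) \<longleftrightarrow> (\<exists>us x y vs. t = us @ [Pri x, Sec y] @ vs \<and> \<not> gg_c (Pri x) (Sec y))"
    unfolding Phi_step.simps by (metis surj_pair)
  then show ?thesis unfolding append_Cons append_Nil by blast
qed

lemma Psi_irreducible_iff:
  "(\<nexists>u. Psi_step t u) \<longleftrightarrow> (\<forall>us x y vs. t = us @ Sec x # Pri y # vs \<longrightarrow> gt_c (lower x) y)"
proof -
  have "(\<exists>u. Psi_step t u) \<longleftrightarrow> (\<exists>us x y vs. t = us @ [Sec x, Pri y] @ vs \<and> \<not> gt_c (lower x) y)"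
    unfolding Psi_step.simps by (metis surj_pair)
  then show ?thesis unfolding append_Cons append_Nil by blast
qed

section \<open>The set \<open>\<D>\<close>: coherent sequences without steps of \<open>\<Phi>\<close>\<close>

text \<open>The induction hypothesis that lets \<open>\<gg>\<^sub>c\<close> propagate across a run of parts of the other kind.
  Write \<open>K\<close> and \<open>L\<close> for primary and secondary values and \<open>A\<close> for the number of ascents from the
  letter of the primary part, respectively from the lower letter of the secondary part, at the
  head. The conditions then read \<open>2 * L \<le> K - A + 1\<close> for all secondary values \<open>L\<close> after a primary
  head of value \<open>K\<close>, and \<open>2 * L + A > K\<close> for all primary values \<open>K\<close> after a secondary head of
  value \<open>L\<close>.\<close>

fun head_bound :: "'c::linorder part list \<Rightarrow> bool" where
  "head_bound [] \<longleftrightarrow> True"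
| "head_bound (Pri (k, p) # xs) \<longleftrightarrow>
     (\<forall>l\<in>set (svals xs). 2 * l \<le> k - 2 * ascents (p # colors xs) + 1)"
| "head_bound (Sec (l, p, q) # xs) \<longleftrightarrow>
     (\<forall>k\<in>set (pvals xs). 2 * l - ascents (q # colors xs) > k)"

text \<open>Passing to the next part within a run of primary parts lowers \<open>K\<close> by at least \<open>1\<close> and \<open>A\<close>
  by at most \<open>1\<close>, so \<open>K - A\<close> does not increase; within a run of secondary parts, neither \<open>L\<close> nor
  \<open>A\<close> increases. Hence both conditions of \<open>head_bound\<close> extend to the left.\<close>

lemma sorted_vals_if_gg:
  assumes "successively gg_c xs"
  shows "sorted_wrt (>) (pvals xs) \<and> sorted_wrt (\<ge>) (svals xs) \<and> head_bound xs"
  using assms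
proof (induction xs rule: induct_list012)
  case (2 x)
  then show ?case by (cases x rule: part.exhaust) auto
next
  case (3 x y zs)
  have IH: "sorted_wrt (>) (pvals (y # zs))" "sorted_wrt (\<ge>) (svals (y # zs))" "head_bound (y # zs)"
    using 3 by auto
  have xy: "gg_c x y" using 3 by simp
  show ?case
  proof (cases "(x, y)" rule: gg_c.cases)
    case (1 k p l q)
    then show ?thesis using IH xy delta_le_1[of p q] by (auto; smt (verit))
  next
    case (2 k p l q r)
    then show ?thesis using IH xy delta_nonneg[of q r] delta_le_1[of p q] by (auto; smt (verit))
  next
    case (3 k p q l r)
    then show ?thesis using IH xy delta_le_1[of q r] by (auto; smt (verit))
  next
    case (4 k p q l r t)
    then show ?thesis using IH xy delta_nonneg[of q r] delta_nonneg[of r t] by (auto; smt (verit))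
  qed
qed auto

text \<open>Positivity is what makes \<open>x \<gg>\<^sub>c y\<close> stronger than \<open>x \<gg>\<^sub>c \<gamma>(y)\<close>: for
  \<open>y = (l, q, r)\<close> it gives \<open>2 * l \<ge> l + 1\<close>.\<close>

lemma gg_prim_sec_imp_weak:
  assumes "gg_c (Pri x) (Sec y)" "pos_part (Sec y)"
  shows "weak_adj (Pri x) (Sec y)"
proof -
  obtain k p l q r where "x = (k, p)" "y = (l, q, r)" by (metis surj_pair)
  then show ?thesis using assms delta_nonneg[of q r] by simp
qed

lemma coherent_if_D:
  assumes "xs \<in> D_seqs"
  shows "coherent xs"
proof -
  have "weak_adj a b" if "xs = us @ a # b # vs" for us a b vs
  proof -
    have "gg_c a b" "pos_part b"
      using assms that by (auto simp: D_seqs_def successively_append_iff)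
    then show ?thesis
    proof (cases "\<exists>x y. a = Pri x \<and> b = Sec y")
      case True
      then show ?thesis using \<open>gg_c a b\<close> \<open>pos_part b\<close> gg_prim_sec_imp_weak by blast
    qed (cases a; cases b; auto)
  qed
  then have "successively weak_adj xs" unfolding successively_iff_adjacent by blast
  then show ?thesis
    using assms sorted_vals_if_gg[of xs] by (simp add: D_seqs_def coherent_def)
qed

lemma D_iff_coherent: "xs \<in> D_seqs \<longleftrightarrow> coherent xs \<and> (\<nexists>u. Phi_step xs u)"
proof (intro iffI conjI)
  assume D: "xs \<in> D_seqs"
  then show "coherent xs" by (rule coherent_if_D)
  show "\<nexists>u. Phi_step xs u"
    unfolding Phi_irreducible_iff using D by (auto simp: D_seqs_def successively_append_iff)
next
  assume *: "coherent xs \<and> (\<nexists>u. Phi_step xs u)"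
  have "gg_c a b" if "xs = us @ a # b # vs" for us a b vs
  proof -
    have "weak_adj a b"
      using * that by (auto simp: coherent_def successively_append_iff)
    moreover have "gg_c (Pri x) (Sec y)" if "a = Pri x" "b = Sec y" for x y
      using * \<open>xs = us @ a # b # vs\<close> that unfolding Phi_irreducible_iff by blast
    ultimately show ?thesis by (cases "(a, b)" rule: gg_c.cases) auto
  qed
  then show "xs \<in> D_seqs"
    using * by (auto simp: D_seqs_def coherent_def successively_iff_adjacent)
qed

section \<open>Greedy sequences: coherent sequences without steps of \<open>\<Psi>\<close>\<close>

text \<open>The relation between neighbours after the first step of \<open>\<Phi>\<close>. It compares the last half
  of the left part with the first half of the right one: halves decrease for \<open>>\<^sub>c\<close>, and a half that
  was left unpaired is moreover \<open>\<gg>\<^sub>c\<close> its successor.\<close>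

fun greedy_adj :: "'c::linorder part \<Rightarrow> 'c part \<Rightarrow> bool" where
  "greedy_adj (Pri x) b \<longleftrightarrow> gg_c (Pri x) (Pri (hd (halves b)))"
| "greedy_adj (Sec e) b \<longleftrightarrow> gt_c (lower e) (hd (halves b))"

text \<open>The sequences that the first step of \<open>\<Phi>\<close> can produce.\<close>

definition greedy_seqs :: "'c::linorder part list set" where
  "greedy_seqs = {xs. successively greedy_adj xs \<and> (\<forall>x\<in>set xs. pos_part x)}"

lemma halves_nonempty [simp]: "halves a \<noteq> []"
  by (cases a) auto

lemma gt_c_if_gg_c: "gg_c (Pri x) (Pri y) \<Longrightarrow> gt_c x y"
  by (cases x; cases y) auto

lemma gt_c_upper_lower: "gt_c (upper e) (lower e)"
  and not_gg_c_upper_lower: "\<not> gg_c (Pri (upper e)) (Pri (lower e))"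
  and fst_upper_ge: "fst (upper e) \<ge> fst e"
  and fst_lower: "fst (lower e) = fst e"
  by (cases e; simp add: delta_nonneg)+

lemma upper_lower_inject: "upper e = upper e' \<Longrightarrow> lower e = lower e' \<Longrightarrow> e = e'"
  by (cases e; cases e') auto

lemma join_upper_lower: "fst e > 0 \<Longrightarrow> join (upper e) (lower e) = e"
  unfolding join_def by (rule the_equality) (auto intro: upper_lower_inject)

lemma Phi1_C:
  assumes "xs \<in> C_seqs"
  shows "concat (map halves (Phi1 xs)) = xs \<and> Phi1 xs \<in> greedy_seqs"
  using assms
proof (induction xs rule: Phi1.induct)
  case (3 x y zs)
  have xy: "gt_c x y" and yzs: "y # zs \<in> C_seqs" and zs: "zs \<in> C_seqs"
    and yz: "zs \<noteq> [] \<Longrightarrow> gt_c y (hd zs)" and pos: "fst x > 0" "fst y > 0"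
    using "3.prems" by (auto simp: C_seqs_def successively_Cons)
  show ?case
  proof (cases "gg_c (Pri x) (Pri y)")
    case True
    with "3.IH"(1) yzs have IH: "concat (map halves (Phi1 (y # zs))) = y # zs"
      "Phi1 (y # zs) \<in> greedy_seqs" by auto
    then obtain b bs where b: "Phi1 (y # zs) = b # bs" by (cases "Phi1 (y # zs)") auto
    with IH(1) have "hd (halves b) = y" by (cases b) auto
    then show ?thesis using IH True pos by (auto simp: greedy_seqs_def b)
  next
    case False
    with "3.IH"(2) zs have IH: "concat (map halves (Phi1 zs)) = zs" "Phi1 zs \<in> greedy_seqs"
      by auto
    obtain e where e: "fst e > 0" "x = upper e" "y = lower e"
      using join_ex1[OF xy False pos(2)] by blast
    have "successively greedy_adj (Sec e # Phi1 zs)"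
    proof (cases "Phi1 zs")
      case (Cons b bs)
      with IH(1) have "zs \<noteq> []" "hd zs = hd (halves b)" by (cases b; auto)+
      then show ?thesis using IH(2) yz by (simp add: greedy_seqs_def Cons e)
    qed simp
    then show ?thesis using IH False e by (simp add: greedy_seqs_def join_upper_lower)
  qed
qed (auto simp: C_seqs_def greedy_seqs_def)

lemma halves_greedy:
  assumes "ys \<in> greedy_seqs"
  shows "concat (map halves ys) \<in> C_seqs \<and> Phi1 (concat (map halves ys)) = ys"
  using assms
proof (induction ys)
  case (Cons a ys)
  define h where "h = concat (map halves ys)"
  have ys: "ys \<in> greedy_seqs" and a: "pos_part a"
    and adj: "ys \<noteq> [] \<Longrightarrow> greedy_adj a (hd ys)"
    using Cons.prems by (auto simp: greedy_seqs_def successively_Cons)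
  have IH: "h \<in> C_seqs" "Phi1 h = ys" using Cons.IH[OF ys] by (simp_all add: h_def)
  have h: "h \<noteq> [] \<longleftrightarrow> ys \<noteq> []" "ys \<noteq> [] \<Longrightarrow> hd h = hd (halves (hd ys))"
    by (cases ys; simp add: h_def)+
  show ?case
  proof (cases a)
    case (Pri x)
    have "gg_c (Pri x) (Pri (hd h))" if "h \<noteq> []" using adj h that by (simp add: Pri)
    then show ?thesis using IH a
      by (cases h) (auto simp: Pri C_seqs_def gt_c_if_gg_c simp flip: h_def)
  next
    case (Sec e)
    have "gt_c (lower e) (hd h)" if "h \<noteq> []" using adj h that by (simp add: Sec)
    then show ?thesis using IH a fst_upper_ge[of e]
      by (cases h) (auto simp: Sec C_seqs_def gt_c_upper_lower not_gg_c_upper_lower fst_lower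
          join_upper_lower simp flip: h_def)
  qed
qed (simp add: C_seqs_def)

text \<open>The value of the head dominates all later values, strictly if the head is primary. In
  contrast to \<open>\<D>\<close>, a greedy sequence is sorted by value, whatever the kinds of its parts.\<close>

fun head_dominates :: "'c::linorder part list \<Rightarrow> bool" where
  "head_dominates [] \<longleftrightarrow> True"
| "head_dominates (Pri (k, p) # xs) \<longleftrightarrow>
     (\<forall>v\<in>set (pvals xs) \<union> set (svals xs). k - ascents (p # colors xs) > v)"
| "head_dominates (Sec (k, p, q) # xs) \<longleftrightarrow>
     (\<forall>v\<in>set (pvals xs) \<union> set (svals xs). k - ascents (q # colors xs) \<ge> v)"

lemma sorted_vals_if_greedy:
  assumes "successively greedy_adj xs"
  shows "sorted_wrt (>) (pvals xs) \<and> sorted_wrt (\<ge>) (svals xs) \<and> head_dominates xs"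
  using assms
proof (induction xs rule: induct_list012)
  case (2 x)
  then show ?case by (cases x rule: part.exhaust) auto
next
  case (3 x y zs)
  have IH: "sorted_wrt (>) (pvals (y # zs))" "sorted_wrt (\<ge>) (svals (y # zs))"
    "head_dominates (y # zs)"
    using 3 by auto
  have xy: "greedy_adj x y" using 3 by simp
  show ?case using IH xy by (cases "(x, y)" rule: gg_c.cases) (auto simp: ball_Un)
qed auto

text \<open>Here positivity makes \<open>\<mu>(x) >\<^sub>c y\<close> stronger than \<open>x \<gg>\<^sub>c y\<close>.\<close>

lemma greedy_imp_weak: "greedy_adj a b \<Longrightarrow> pos_part a \<Longrightarrow> weak_adj a b"
  by (cases "(a, b)" rule: gg_c.cases) auto

lemma greedy_iff_coherent: "xs \<in> greedy_seqs \<longleftrightarrow> coherent xs \<and> (\<nexists>u. Psi_step xs u)"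
proof (intro iffI conjI)
  assume g: "xs \<in> greedy_seqs"
  have "weak_adj a b" if "xs = us @ a # b # vs" for us a b vs
    using g that by (intro greedy_imp_weak) (auto simp: greedy_seqs_def successively_append_iff)
  then have "successively weak_adj xs" unfolding successively_iff_adjacent by blast
  then show "coherent xs"
    using g sorted_vals_if_greedy[of xs] by (simp add: greedy_seqs_def coherent_def)
  show "\<nexists>u. Psi_step xs u"
    unfolding Psi_irreducible_iff using g by (auto simp: greedy_seqs_def successively_append_iff)
next
  assume *: "coherent xs \<and> (\<nexists>u. Psi_step xs u)"
  have "greedy_adj a b" if "xs = us @ a # b # vs" for us a b vs
  proof -
    have "weak_adj a b"
      using * that by (auto simp: coherent_def successively_append_iff)
    moreover have "gt_c (lower x) y" if "a = Sec x" "b = Pri y" for x y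
      using * \<open>xs = us @ a # b # vs\<close> that unfolding Psi_irreducible_iff by blast
    ultimately show ?thesis by (cases "(a, b)" rule: gg_c.cases) auto
  qed
  then show "xs \<in> greedy_seqs"
    using * by (auto simp: greedy_seqs_def coherent_def successively_iff_adjacent)
qed

section \<open>The two maps are mutually inverse\<close>

lemma the_final_Phi: "final_of Phi_step s t \<Longrightarrow> (THE t. final_of Phi_step s t) = t"
  using Phi_final_ex1 by (rule the1_equality)

lemma the_final_Psi: "final_of Psi_step s t \<Longrightarrow> (THE t. final_of Psi_step s t) = t"
  using Psi_final_ex1 by (rule the1_equality)

lemma final_of_Phi_iff_Psi:
  "s \<in> greedy_seqs \<and> final_of Phi_step s t \<longleftrightarrow> t \<in> D_seqs \<and> final_of Psi_step t s"
  unfolding greedy_iff_coherent D_iff_coherent final_of_def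
  using coherent_Phi_steps coherent_Psi_steps by blast

lemma Phi_C:
  assumes "xs \<in> C_seqs"
  shows "Phi xs \<in> D_seqs" "Psi (Phi xs) = xs"
proof -
  obtain t where t: "final_of Phi_step (Phi1 xs) t" using Phi_final_ex1 by blast
  then have Phi: "Phi xs = t" unfolding Phi_def by (rule the_final_Phi)
  have *: "t \<in> D_seqs" "final_of Psi_step t (Phi1 xs)"
    using final_of_Phi_iff_Psi t Phi1_C[OF assms] by blast+
  show "Phi xs \<in> D_seqs" using * by (simp add: Phi)
  show "Psi (Phi xs) = xs"
    unfolding Phi Psi_def the_final_Psi[OF *(2)] using Phi1_C[OF assms] by blast
qed

lemma Psi_D:
  assumes "ys \<in> D_seqs"
  shows "Psi ys \<in> C_seqs" "Phi (Psi ys) = ys"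
proof -
  obtain s where s: "final_of Psi_step ys s" using Psi_final_ex1 by blast
  then have Psi: "Psi ys = concat (map halves s)" unfolding Psi_def by (simp add: the_final_Psi)
  have *: "s \<in> greedy_seqs" "final_of Phi_step s ys"
    using final_of_Phi_iff_Psi s assms by blast+
  show "Psi ys \<in> C_seqs" using halves_greedy[OF *(1)] by (simp add: Psi)
  show "Phi (Psi ys) = ys"
    using halves_greedy[OF *(1)] by (simp add: Psi Phi_def the_final_Phi[OF *(2)])
qed

theorem mainTheorem4:
  shows "(Phi :: 'c::{finite, linorder} prim list \<Rightarrow> 'c part list) \<in> C_seqs \<rightarrow> D_seqs \<and>
    (Psi :: 'c part list \<Rightarrow> 'c prim list) \<in> D_seqs \<rightarrow> C_seqs \<and>
    (\<forall>xs \<in> (C_seqs :: 'c prim list set). Psi (Phi xs) = xs) \<and>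
    (\<forall>ys \<in> (D_seqs :: 'c part list set). Phi (Psi ys) = ys)"
  using Phi_C Psi_D by blast

end
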